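(* Let $V_n$ be the approximating graphs of the Diamond fractal (defined in the context). Then for all $n\ge1$, $$\tau(V_n)=2^{\frac23(4^n-1)}.$$
   Context: $V_0$ is a single edge joining two vertices $x_1,x_2$. For $n\ge1$, $V_n$ is obtained from $V_{n-1}$ by replacing each edge $\{u,v\}$ by a "diamond": two new vertices $a,b$ (distinct for different edges) and the four edges $ua,av,vb,bu$, the edge $\{u,v\}$ itself being removed. Thus $V_1$ is a 4-cycle and $V_n$ has $4^n$ edges. $\tau(G)$ denotes the number of spanning trees of $G$. *)

theory Defs
  imports Complex_Main
begin

text \<open>
  Finite simple graphs are given by a vertex set \<open>V\<close> and a set \<open>E\<close> of edges, each edge being a
  two-element subset of \<open>V\<close>.
\<close>

definition simple_graph :: "'a set \<Rightarrow> 'a set set \<Rightarrow> bool" where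
  "simple_graph V E \<longleftrightarrow> finite V \<and> (\<forall>e\<in>E. e \<subseteq> V \<and> card e = 2)"

definition adj_rel :: "'a set set \<Rightarrow> ('a \<times> 'a) set" where
  "adj_rel E = {(u, v). {u, v} \<in> E}"

definition graph_connected :: "'a set \<Rightarrow> 'a set set \<Rightarrow> bool" where
  "graph_connected V E \<longleftrightarrow> V \<noteq> {} \<and> (\<forall>u\<in>V. \<forall>v\<in>V. (u, v) \<in> (adj_rel E)\<^sup>*)"

text \<open>A cycle is listed by its distinct vertices, the first one not being repeated at the end.\<close>

definition is_cycle :: "'a set set \<Rightarrow> 'a list \<Rightarrow> bool" where
  "is_cycle E xs \<longleftrightarrow> 3 \<le> length xs \<and> distinct xs \<and>
     (\<forall>i<length xs. {xs ! i, xs ! (Suc i mod length xs)} \<in> E)"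

definition graph_acyclic :: "'a set set \<Rightarrow> bool" where
  "graph_acyclic E \<longleftrightarrow> (\<nexists>xs. is_cycle E xs)"

definition is_tree :: "'a set \<Rightarrow> 'a set set \<Rightarrow> bool" where
  "is_tree V E \<longleftrightarrow> simple_graph V E \<and> graph_connected V E \<and> graph_acyclic E"

text \<open>A spanning tree has vertex set \<open>V\<close>, hence is identified with its edge set.\<close>

definition spanning_trees :: "'a set \<Rightarrow> 'a set set \<Rightarrow> 'a set set set" where
  "spanning_trees V E = {T. T \<subseteq> E \<and> is_tree V T}"

definition num_spanning_trees :: "'a set \<Rightarrow> 'a set set \<Rightarrow> nat" where
  "num_spanning_trees V E = card (spanning_trees V E)"

text \<open>
  \<open>diamond_graph n V E\<close> says that \<open>(V, E)\<close> is (a realisation of) the \<open>n\<close>-th approximating graph.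
  In a step, \<open>a e\<close> and \<open>b e\<close> are the two new vertices belonging to the edge \<open>e\<close>; an edge
  \<open>e = {u, v}\<close> contributes the four edges \<open>{u, a e}\<close>, \<open>{v, a e}\<close>, \<open>{u, b e}\<close>, \<open>{v, b e}\<close>.
\<close>

inductive diamond_graph :: "nat \<Rightarrow> 'a set \<Rightarrow> 'a set set \<Rightarrow> bool" where
  diamond_0: "x1 \<noteq> x2 \<Longrightarrow> diamond_graph 0 {x1, x2} {{x1, x2}}"
| diamond_Suc: "\<lbrakk>diamond_graph n V E;
     inj_on a E; inj_on b E; a ` E \<inter> b ` E = {}; (a ` E \<union> b ` E) \<inter> V = {}\<rbrakk> \<Longrightarrow>
     diamond_graph (Suc n) (V \<union> a ` E \<union> b ` E)
       ({{w, a e} | w e. e \<in> E \<and> w \<in> e} \<union> {{w, b e} | w e. e \<in> E \<and> w \<in> e})"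

lemma diamond_graph_simple: "diamond_graph n V E \<Longrightarrow> simple_graph V E"
proof (induction rule: diamond_graph.induct)
  case (diamond_0 x1 x2)
  then show ?case by (auto simp: simple_graph_def)
next
  case (diamond_Suc n V E a b)
  have sub: "e \<subseteq> V" if "e \<in> E" for e
    using diamond_Suc.IH that by (auto simp: simple_graph_def)
  have "finite V" using diamond_Suc.IH by (simp add: simple_graph_def)
  moreover have "finite E"
    using finite_subset[of E "Pow V"] sub \<open>finite V\<close> by blast
  moreover have "w \<noteq> a e" "w \<noteq> b e" "w \<in> V" if "e \<in> E" "w \<in> e" for w e
    using sub that diamond_Suc.hyps by blast+
  ultimately show ?case
    unfolding simple_graph_def by (fastforce simp: card_insert_if)
qed

lemma diamond_graph_finite_edges: "diamond_graph n V E \<Longrightarrow> finite E"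
  using diamond_graph_simple[of n V E] finite_subset[of E "Pow V"]
  by (auto simp: simple_graph_def)

lemma diamond_graph_exists:
  assumes "infinite (UNIV :: 'a set)"
  shows "\<exists>V E. diamond_graph n (V :: 'a set) E"
proof (induction n)
  case 0
  obtain x1 x2 :: 'a where "x1 \<noteq> x2"
    using assms by (metis UNIV_eq_I finite.emptyI finite.insertI singleton_iff)
  then show ?case by (blast intro: diamond_graph.diamond_0)
next
  case (Suc n)
  then obtain V :: "'a set" and E where VE: "diamond_graph n V E" by blast
  have fin: "finite V" "finite E"
    using diamond_graph_simple[OF VE] diamond_graph_finite_edges[OF VE]
    by (auto simp: simple_graph_def)
  have "\<exists>B. finite B \<and> card B = card (E \<times> (UNIV :: bool set)) \<and> B \<subseteq> - V"
    using infinite_arbitrarily_large[of "- V"] assms fin by (metis finite_compl)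
  then obtain B where B: "finite B" "card B = card (E \<times> (UNIV :: bool set))" "B \<subseteq> - V"
    by blast
  then obtain h where "bij_betw h (E \<times> (UNIV :: bool set)) B"
    by (metis finite_same_card_bij finite_SigmaI fin(2) finite)
  then have h: "inj_on h (E \<times> UNIV)" "h ` (E \<times> UNIV) \<subseteq> - V"
    using B(3) by (auto simp: bij_betw_def)
  show ?case
    using diamond_graph.diamond_Suc[OF VE, of "\<lambda>e. h (e, True)" "\<lambda>e. h (e, False)"] h
    by (auto simp: inj_on_def) blast
qed

lemma diamond_graph_card_edges: "diamond_graph n V E \<Longrightarrow> card E = 4 ^ n"
proof (induction rule: diamond_graph.induct)
  case (diamond_0 x1 x2)
  then show ?case by simp
next
  case (diamond_Suc n V E a b)
  have sub: "e \<subseteq> V" "card e = 2" if "e \<in> E" for e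
    using diamond_graph_simple[OF diamond_Suc.hyps(1)] that by (auto simp: simple_graph_def)
  have finE: "finite E" using diamond_graph_finite_edges[OF diamond_Suc.hyps(1)] .
  have finS: "finite e" if "e \<in> E" for e
    using sub(2)[OF that] by (metis card.infinite zero_neq_numeral)
  let ?S = "SIGMA e:E. e"
  have cS: "card ?S = 2 * 4 ^ n"
    using finE finS sub(2) diamond_Suc.IH by (simp add: card_SigmaI)
  have img: "{{w, c e} | w e. e \<in> E \<and> w \<in> e} = (\<lambda>(e, w). {w, c e}) ` ?S" for c :: "'a set \<Rightarrow> 'a"
    by auto
  have fresh: "c e \<notin> V" if "e \<in> E" "c = a \<or> c = b" for c e
    using diamond_Suc.hyps that by blast
  have inj: "inj_on (\<lambda>(e, w). {w, c e}) ?S" if c: "c = a \<or> c = b" for c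
  proof (rule inj_onI, clarify)
    fix e w e' w'
    assume *: "e \<in> E" "w \<in> e" "e' \<in> E" "w' \<in> e'" "{w, c e} = {w', c e'}"
    have "w \<in> V" "w' \<in> V" using * sub by blast+
    then have "w = w' \<and> c e = c e'" using * fresh[OF _ c] by (metis doubleton_eq_iff)
    then show "e = e' \<and> w = w'"
      using * c diamond_Suc.hyps(2,3) by (auto dest: inj_onD)
  qed
  have disj: "(\<lambda>(e, w). {w, a e}) ` ?S \<inter> (\<lambda>(e, w). {w, b e}) ` ?S = {}"
  proof -
    have False if *: "e \<in> E" "w \<in> e" "e' \<in> E" "w' \<in> e'" "{w, a e} = {w', b e'}" for e w e' w'
    proof -
      have "w \<in> V" "w' \<in> V" using * sub by blast+
      then have "a e = b e'" using * fresh by (metis doubleton_eq_iff)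
      then show False using * diamond_Suc.hyps(4) by blast
    qed
    then show ?thesis by auto
  qed
  have "finite ?S" using finE finS by auto
  then show ?case
    unfolding img using disj inj[of a] inj[of b] cS
    by (simp add: card_Un_disjoint card_image)
qed

end

theory Submission
  imports Defs "HOL-Library.FuncSet"
begin

text \<open>
  In a subgraph \<open>T'\<close> of the subdivided graph, call an edge \<open>e = {u, v}\<close> of the original graph
  linked if one of the paths \<open>u, a e, v\<close> and \<open>u, b e, v\<close> lies in \<open>T'\<close>. Then \<open>T'\<close> is a spanning tree
  iff the linked edges form a spanning tree of the original graph, the diamond of every linked edge
  contributes 3 of its 4 edges, and that of every other edge contributes exactly one edge
  at \<open>a e\<close> and one at \<open>b e\<close>. As there are 4 choices in either case, one subdivision step multiplies
  the number of spanning trees by \<open>4 ^ card E\<close>.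
\<close>

section \<open>Trees and their number of edges\<close>

lemma simple_graph_finite_edges: "simple_graph V E \<Longrightarrow> finite E"
  unfolding simple_graph_def by (meson Pow_iff finite_Pow_iff finite_subset subsetI)

lemma simple_graph_subset: "simple_graph V E \<Longrightarrow> T \<subseteq> E \<Longrightarrow> simple_graph V T"
  unfolding simple_graph_def by blast

lemma adj_rel_iff: "(u, v) \<in> adj_rel E \<longleftrightarrow> {u, v} \<in> E"
  by (simp add: adj_rel_def)

lemma adj_rel_mono: "T \<subseteq> E \<Longrightarrow> adj_rel T \<subseteq> adj_rel E"
  by (auto simp: adj_rel_def)

lemma sym_adj_rel_rtrancl: "(u, v) \<in> (adj_rel E)\<^sup>* \<Longrightarrow> (v, u) \<in> (adj_rel E)\<^sup>*"
proof -
  have "sym (adj_rel E)"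
    by (auto simp: sym_def adj_rel_def insert_commute)
  then show "(u, v) \<in> (adj_rel E)\<^sup>* \<Longrightarrow> (v, u) \<in> (adj_rel E)\<^sup>*"
    by (meson sym_rtrancl symE)
qed

section \<open>Connected graphs and a lower bound on their number of edges\<close>

lemma rtrancl_leaves_set:
  assumes "(u, v) \<in> r\<^sup>*" "u \<in> S" "v \<notin> S"
  shows "\<exists>x y. (x, y) \<in> r \<and> x \<in> S \<and> y \<notin> S"
  using assms by (induction rule: rtrancl_induct) auto

text \<open>Grows a subtree one vertex at a time: as long as some vertex lies outside
  \<open>S\<close>, a walk from \<open>S\<close> to it crosses the boundary, and the crossing edge
  adds exactly one vertex and one edge.\<close>

lemma connected_grow:
  assumes G: "simple_graph V E" "graph_connected V E"
  shows "Suc k \<le> card V \<Longrightarrow>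
    \<exists>S T. S \<subseteq> V \<and> T \<subseteq> E \<and> finite T \<and> card S = Suc k \<and> card T = k \<and> \<Union>T \<subseteq> S \<and> graph_connected S T"
proof (induction k)
  case 0
  obtain v where "v \<in> V" using G by (auto simp: graph_connected_def)
  then show ?case
    by (intro exI[of _ "{v}"] exI[of _ "{}"]) (auto simp: graph_connected_def)
next
  case (Suc k)
  then obtain S T where ST: "S \<subseteq> V" "T \<subseteq> E" "finite T" "card S = Suc k" "card T = k"
    "\<Union>T \<subseteq> S" "graph_connected S T" by auto
  have fS: "finite S" using ST(4) by (metis card.infinite nat.distinct(1))
  obtain u where u: "u \<in> S" using ST(7) by (auto simp: graph_connected_def)
  obtain v where v: "v \<in> V" "v \<notin> S"
    using Suc.prems ST(1,4) by (metis Suc_n_not_le_n subsetI subset_antisym)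
  have "(u, v) \<in> (adj_rel E)\<^sup>*" using G u v ST(1) by (auto simp: graph_connected_def)
  then obtain x y where xy: "{x, y} \<in> E" "x \<in> S" "y \<notin> S"
    using rtrancl_leaves_set[of u v "adj_rel E" S] u v by (auto simp: adj_rel_iff)
  have yV: "y \<in> V" using xy G by (auto simp: simple_graph_def)
  have new: "{x, y} \<notin> T" using xy ST(6) by auto
  let ?T = "insert {x, y} T"
  have mono: "(adj_rel T)\<^sup>* \<subseteq> (adj_rel ?T)\<^sup>*" by (intro rtrancl_mono adj_rel_mono) auto
  have to_x: "(w, x) \<in> (adj_rel ?T)\<^sup>*" if "w \<in> insert y S" for w
  proof (cases "w = y")
    case True
    then show ?thesis by (auto simp: adj_rel_iff insert_commute intro!: r_into_rtrancl)
  next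
    case False
    then show ?thesis using that ST(7) xy(2) mono by (auto simp: graph_connected_def)
  qed
  have "graph_connected (insert y S) ?T"
    unfolding graph_connected_def using to_x sym_adj_rel_rtrancl[of _ x ?T]
    by (meson insert_not_empty rtrancl_trans)
  then show ?case
    using ST xy yV new fS
    by (intro exI[of _ "insert y S"] exI[of _ ?T]) auto
qed

text \<open>The growth is run until all vertices are reached. Only the edge count of
  \<open>T\<close> is recorded, not its acyclicity, because trees are about to be characterised by
  that count.\<close>

lemma connected_spanning_subset:
  assumes G: "simple_graph V E" "graph_connected V E"
  obtains T where "T \<subseteq> E" "graph_connected V T" "card T + 1 = card V"
proof -
  have fV: "finite V" and ne: "V \<noteq> {}"
    using G by (auto simp: simple_graph_def graph_connected_def)
  then obtain k where k: "card V = Suc k" by (metis card_eq_0_iff not0_implies_Suc)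
  then obtain S T where "S \<subseteq> V" "T \<subseteq> E" "card S = Suc k" "card T = k" "graph_connected S T"
    using connected_grow[OF G, of k] by auto
  moreover have "S = V" using calculation k fV by (metis card_subset_eq)
  ultimately show ?thesis using that k by simp
qed

lemma connected_card_le:
  assumes "simple_graph V E" "graph_connected V E"
  shows "card V \<le> card E + 1"
  using connected_spanning_subset[OF assms] card_mono simple_graph_finite_edges assms
  by (metis add_le_mono1)

section \<open>Cycles and redundant edges\<close>

lemma rtrancl_adj_rel_imp_path:
  assumes "(u, v) \<in> (adj_rel E)\<^sup>*"
  shows "\<exists>xs. xs \<noteq> [] \<and> hd xs = u \<and> last xs = v \<and> distinct xs \<and>
    (\<forall>i. Suc i < length xs \<longrightarrow> {xs ! i, xs ! Suc i} \<in> E)"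
  using assms
proof (induction rule: rtrancl_induct)
  case base
  show ?case by (rule exI[of _ "[u]"]) auto
next
  case (step y z)
  then obtain xs where xs: "xs \<noteq> []" "hd xs = u" "last xs = y" "distinct xs"
    "\<forall>i. Suc i < length xs \<longrightarrow> {xs ! i, xs ! Suc i} \<in> E" by blast
  show ?case
  proof (cases "z \<in> set xs")
    case True
    then obtain j where j: "j < length xs" "xs ! j = z" by (auto simp: in_set_conv_nth)
    \<comment> \<open>The walk returns to a vertex already on the path, so the path is cut off
      there.\<close>
    then have "last (take (Suc j) xs) = z" by (simp add: take_Suc_conv_app_nth)
    then show ?thesis
      using xs j by (intro exI[of _ "take (Suc j) xs"]) auto
  next
    case False
    have "{(xs @ [z]) ! i, (xs @ [z]) ! Suc i} \<in> E" if "Suc i < length (xs @ [z])" for i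
    proof (cases "Suc i < length xs")
      case True
      then show ?thesis using xs by (simp add: nth_append)
    next
      case False
      then have "i = length xs - 1" using that by auto
      then show ?thesis using step(2) xs
        by (auto simp: nth_append last_conv_nth adj_rel_iff)
    qed
    then show ?thesis using xs False by (intro exI[of _ "xs @ [z]"]) auto
  qed
qed

text \<open>A path from \<open>u\<close> to \<open>v\<close> inside \<open>T\<close> has at least
  three vertices because \<open>{u, v}\<close> is missing from \<open>T\<close>; the edge
  \<open>{u, v}\<close> of \<open>E\<close> closes it to a cycle.\<close>

lemma connected_endpoints_imp_cycle:
  assumes "(u, v) \<in> (adj_rel T)\<^sup>*" "u \<noteq> v" "{u, v} \<notin> T" "T \<subseteq> E" "{u, v} \<in> E"
  shows "\<not> graph_acyclic E"
proof -
  obtain xs where xs: "xs \<noteq> []" "hd xs = u" "last xs = v" "distinct xs"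
    "\<forall>i. Suc i < length xs \<longrightarrow> {xs ! i, xs ! Suc i} \<in> T"
    using rtrancl_adj_rel_imp_path[OF assms(1)] by blast
  have uv: "xs ! 0 = u" "xs ! (length xs - 1) = v"
    using xs by (auto simp: hd_conv_nth last_conv_nth)
  have "length xs \<noteq> 0" "length xs \<noteq> 1" using xs(1) uv assms(2) by auto
  moreover have "length xs \<noteq> 2" using xs(5) uv assms(3) by (auto simp: numeral_2_eq_2)
  ultimately have len: "3 \<le> length xs" by linarith
  have "{xs ! i, xs ! (Suc i mod length xs)} \<in> E" if "i < length xs" for i
  proof (cases "Suc i < length xs")
    case True
    then show ?thesis using xs(5) assms(4) by auto
  next
    case False
    then have "i = length xs - 1" "Suc i = length xs" using that by auto
    then show ?thesis using uv assms(5) by (simp add: insert_commute)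
  qed
  then show ?thesis unfolding graph_acyclic_def is_cycle_def using len xs(4) by blast
qed

text \<open>The edge from the last to the first vertex of the cycle can go: the rest of the cycle
  still joins its ends, so every walk can be rerouted.\<close>

lemma cycle_imp_removable_edge:
  assumes "is_cycle E xs" and conn: "graph_connected V E"
  shows "\<exists>e\<in>E. graph_connected V (E - {e})"
proof -
  let ?n = "length xs"
  have n: "3 \<le> ?n" and d: "distinct xs"
    and ed: "\<And>i. i < ?n \<Longrightarrow> {xs ! i, xs ! (Suc i mod ?n)} \<in> E"
    using assms(1) by (auto simp: is_cycle_def)
  let ?u = "xs ! 0" and ?v = "xs ! (?n - 1)"
  let ?F = "E - {{?v, ?u}}"
  have "Suc (?n - 1) = ?n" using n by linarith
  then have e: "{?v, ?u} \<in> E" using ed[of "?n - 1"] n by (auto simp del: Suc_pred)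
  have F: "{xs ! i, xs ! Suc i} \<in> ?F" if "Suc i < ?n" for i
  proof -
    have "{xs ! i, xs ! Suc i} \<noteq> {?v, ?u}"
    proof
      assume "{xs ! i, xs ! Suc i} = {?v, ?u}"
      then consider "xs ! i = ?v" "xs ! Suc i = ?u" | "xs ! i = ?u" "xs ! Suc i = ?v"
        by (auto simp: doubleton_eq_iff)
      then show False
      proof cases
        case 1
        have "Suc i = 0" by (rule nth_eq_iff_index_eq[OF d, THEN iffD1, OF _ _ 1(2)]) (use that in auto)
        then show False by simp
      next
        case 2
        have "i = 0" by (rule nth_eq_iff_index_eq[OF d, THEN iffD1, OF _ _ 2(1)]) (use that in auto)
        moreover have "Suc i = ?n - 1"
          by (rule nth_eq_iff_index_eq[OF d, THEN iffD1, OF _ _ 2(2)]) (use that in auto)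
        ultimately show False using n by linarith
      qed
    qed
    then show ?thesis using ed[of i] that by auto
  qed
  have "(?u, xs ! i) \<in> (adj_rel ?F)\<^sup>*" if "i < ?n" for i
    using that
  proof (induction i)
    case (Suc i)
    have "(xs ! i, xs ! Suc i) \<in> adj_rel ?F" using F[OF Suc.prems] by (simp add: adj_rel_iff)
    then show ?case using Suc by (meson Suc_lessD rtrancl.rtrancl_into_rtrancl)
  qed auto
  then have uv: "(?u, ?v) \<in> (adj_rel ?F)\<^sup>*" using n by auto
  have "adj_rel E \<subseteq> (adj_rel ?F)\<^sup>*"
  proof clarify
    fix x y assume xy: "(x, y) \<in> adj_rel E"
    show "(x, y) \<in> (adj_rel ?F)\<^sup>*"
    proof (cases "{x, y} = {?v, ?u}")
      case True
      then show ?thesis using uv sym_adj_rel_rtrancl[OF uv] by (auto simp: doubleton_eq_iff)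
    next
      case False
      then have "(x, y) \<in> adj_rel ?F" using xy unfolding adj_rel_iff by blast
      then show ?thesis by blast
    qed
  qed
  then have "(adj_rel E)\<^sup>* \<subseteq> (adj_rel ?F)\<^sup>*" by (metis rtrancl_idemp rtrancl_mono)
  then have "graph_connected V ?F" using conn unfolding graph_connected_def by blast
  then show ?thesis using e by blast
qed

text \<open>Replaces acyclicity by an edge count, so that cycles need not be followed through the
  subdivision. If acyclic, a connected spanning subset with \<open>card V - 1\<close> edges must be
  all of \<open>E\<close>; conversely, a cycle would allow a connected graph with too few
  edges.\<close>

lemma is_tree_iff_card:
  "is_tree V E \<longleftrightarrow> simple_graph V E \<and> graph_connected V E \<and> card E + 1 = card V"
proof (cases "simple_graph V E \<and> graph_connected V E")
  case False
  then show ?thesis by (auto simp: is_tree_def)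
next
  case True
  then have G: "simple_graph V E" "graph_connected V E" by auto
  have fE: "finite E" using simple_graph_finite_edges[OF G(1)] .
  have "graph_acyclic E \<longleftrightarrow> card E + 1 = card V"
  proof
    assume ac: "graph_acyclic E"
    obtain T where T: "T \<subseteq> E" "graph_connected V T" "card T + 1 = card V"
      using connected_spanning_subset[OF G] .
    have "E \<subseteq> T"
    proof (rule ccontr)
      assume "\<not> E \<subseteq> T"
      then obtain e where e: "e \<in> E" "e \<notin> T" by blast
      then obtain u v where uv: "e = {u, v}" "u \<noteq> v" "u \<in> V" "v \<in> V"
        using G(1) by (fastforce simp: simple_graph_def card_2_iff)
      then have "(u, v) \<in> (adj_rel T)\<^sup>*" using T(2) by (auto simp: graph_connected_def)
      then show False using connected_endpoints_imp_cycle[of u v T E] e uv T(1) ac by blast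
    qed
    then show "card E + 1 = card V" using T by (metis subset_antisym)
  next
    assume c: "card E + 1 = card V"
    show "graph_acyclic E"
    proof (rule ccontr)
      assume "\<not> graph_acyclic E"
      then obtain e where e: "e \<in> E" "graph_connected V (E - {e})"
        using cycle_imp_removable_edge[OF _ G(2)] by (auto simp: graph_acyclic_def)
      have "card V \<le> card (E - {e}) + 1"
        using connected_card_le[OF simple_graph_subset[OF G(1)] e(2)] by blast
      moreover have "card (E - {e}) < card E" using e fE by (metis card_Diff1_less)
      ultimately show False using c by linarith
    qed
  qed
  then show ?thesis using True by (auto simp: is_tree_def)
qed

section \<open>Subgraphs of a single diamond\<close>

text \<open>
  A set \<open>S \<subseteq> e \<times> UNIV\<close> encodes a subgraph of the diamond of \<open>e\<close>: the pair \<open>(w, i)\<close> stands for the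
  edge joining \<open>w\<close> to the new vertex number \<open>i\<close>.
\<close>

definition attached :: "('a \<times> bool) set \<Rightarrow> bool" where
  "attached S \<longleftrightarrow> (\<forall>i. \<exists>w. (w, i) \<in> S)"

definition linked :: "'a set \<Rightarrow> ('a \<times> bool) set \<Rightarrow> bool" where
  "linked e S \<longleftrightarrow> (\<exists>i. \<forall>w\<in>e. (w, i) \<in> S)"

definition diamond_parts :: "'a set \<Rightarrow> bool \<Rightarrow> ('a \<times> bool) set set" where
  "diamond_parts e l =
    (if l then {S. S \<subseteq> e \<times> UNIV \<and> card S = 3}
     else {{(x, True), (y, False)} | x y. x \<in> e \<and> y \<in> e})"

text \<open>Linked: omit one of the four edges. Not linked: choose an endpoint independently for
  each of the two new vertices.\<close>

lemma card_diamond_parts: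
  assumes "card e = 2"
  shows "card (diamond_parts e l) = 4"
proof -
  have fe: "finite e" using assms by (metis card.infinite zero_neq_numeral)
  show ?thesis
  proof (cases l)
    case True
    have "card {S. S \<subseteq> e \<times> (UNIV :: bool set) \<and> card S = 3} = 4 choose 3"
      using n_subsets[of "e \<times> (UNIV :: bool set)" 3] fe assms by (simp add: card_cartesian_product)
    then show ?thesis using True by (simp add: diamond_parts_def numeral_eq_Suc)
  next
    case False
    have "diamond_parts e l = (\<lambda>(x, y). {(x, True), (y, False)}) ` (e \<times> e)"
      using False by (auto simp: diamond_parts_def)
    moreover have "inj_on (\<lambda>(x, y). {(x, True), (y, False)}) (e \<times> e)"
      by (auto simp: inj_on_def doubleton_eq_iff)
    ultimately show ?thesis using assms by (simp add: card_image card_cartesian_product)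
  qed
qed

lemma diamond_parts_subset: "S \<in> diamond_parts e l \<Longrightarrow> S \<subseteq> e \<times> UNIV"
  by (auto simp: diamond_parts_def split: if_splits)

lemma diamond_parts_card: "S \<in> diamond_parts e l \<Longrightarrow> card S = (if l then 3 else 2)"
  by (auto simp: diamond_parts_def split: if_splits)

lemma finite_diamond_subset: "card e = 2 \<Longrightarrow> S \<subseteq> e \<times> (UNIV :: bool set) \<Longrightarrow> finite S"
  by (metis card.infinite finite_SigmaI finite_code finite_subset zero_neq_numeral)

text \<open>A linked part has both edges at one new vertex and at least one at the other; any
  attached part has one edge at each. \<open>diamond_parts\<close> consists of the extremal
  cases.\<close>

lemma attached_card:
  assumes e: "card e = 2" and S: "S \<subseteq> e \<times> UNIV" "attached S"
  shows "(if linked e S then 3 else 2) \<le> card S"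
    and "card S = (if linked e S then 3 else 2) \<Longrightarrow> S \<in> diamond_parts e (linked e S)"
proof -
  have fS: "finite S" using finite_diamond_subset[OF e S(1)] .
  obtain x y where xy: "(x, True) \<in> S" "(y, False) \<in> S"
    using S(2) by (metis attached_def)
  then have sub: "{(x, True), (y, False)} \<subseteq> S" by blast
  have c2: "card {(x, True), (y, False)} = 2" by simp
  have "2 \<le> card S" using card_mono[OF fS sub] c2 by simp
  moreover have "3 \<le> card S" if l: "linked e S"
  proof -
    obtain i where i: "\<forall>w\<in>e. (w, i) \<in> S" using l unfolding linked_def by blast
    obtain z where z: "(z, \<not> i) \<in> S" using S(2) unfolding attached_def by blast
    have "card (e \<times> {i}) = 2" "(z, \<not> i) \<notin> e \<times> {i}"
      using e by (auto simp: card_cartesian_product)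
    moreover have "finite (e \<times> {i})" by (rule finite_diamond_subset[OF e]) auto
    ultimately have "card (insert (z, \<not> i) (e \<times> {i})) = 3" by simp
    moreover have "insert (z, \<not> i) (e \<times> {i}) \<subseteq> S" using i z by auto
    ultimately show ?thesis using card_mono[OF fS] by metis
  qed
  ultimately show "(if linked e S then 3 else 2) \<le> card S" by simp
  assume c: "card S = (if linked e S then 3 else 2)"
  show "S \<in> diamond_parts e (linked e S)"
  proof (cases "linked e S")
    case True
    then show ?thesis using c S by (simp add: diamond_parts_def)
  next
    case False
    then have "S = {(x, True), (y, False)}" using card_subset_eq[OF fS sub] c c2 by simp
    then show ?thesis using False xy S(1) by (auto simp: diamond_parts_def)
  qed
qed

text \<open>A part of size 3 misses a single pair \<open>(p, j)\<close>: the new vertex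
  \<open>\<not> j\<close> keeps both edges and so links \<open>e\<close>, while \<open>j\<close>
  keeps its edge to the endpoint other than \<open>p\<close>.\<close>

lemma diamond_parts_attached_linked:
  assumes e: "card e = 2" and S: "S \<in> diamond_parts e l"
  shows "attached S" "linked e S = l"
proof -
  have sub: "S \<subseteq> e \<times> UNIV" using diamond_parts_subset[OF S] .
  have fe: "finite (e \<times> (UNIV :: bool set))" using finite_diamond_subset[OF e subset_refl] .
  obtain u v where uv: "e = {u, v}" "u \<noteq> v" using e by (auto simp: card_2_iff)
  have "attached S \<and> linked e S = l"
  proof (cases l)
    case True
    then have c: "card S = 3" using diamond_parts_card[OF S] by simp
    have "card (e \<times> (UNIV :: bool set) - S) = 1"
      using card_Diff_subset[OF finite_subset[OF sub fe] sub] c e by (simp add: card_cartesian_product)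
    then obtain p j where "e \<times> UNIV - S = {(p, j)}" by (metis card_1_singletonE surj_pair)
    then have S_eq: "S = e \<times> UNIV - {(p, j)}" using sub by blast
    have "\<exists>w\<in>e. w \<noteq> p" using uv by auto
    then have "attached S" by (auto simp: attached_def S_eq)
    moreover have "linked e S" unfolding linked_def S_eq by (rule exI[of _ "\<not> j"]) auto
    ultimately show ?thesis using True by simp
  next
    case False
    then obtain x y where "S = {(x, True), (y, False)}" using S by (auto simp: diamond_parts_def)
    then show ?thesis using False uv by (auto simp: attached_def linked_def)
  qed
  then show "attached S" "linked e S = l" by auto
qed

section \<open>Subdividing every edge into a diamond\<close>

text \<open>Indexing the new vertices by \<open>bool\<close> treats both of them uniformly;
  \<open>inj_m\<close> combines the injectivity of the two vertex choices with the disjointness of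
  their ranges.\<close>

locale diamond_step =
  fixes V :: "'a set" and E :: "'a set set" and m :: "'a set \<times> bool \<Rightarrow> 'a"
  assumes simple: "simple_graph V E"
    and inj_m: "inj_on m (E \<times> UNIV)"
    and fresh: "m ` (E \<times> UNIV) \<inter> V = {}"
begin

definition V' :: "'a set" where
  "V' = V \<union> m ` (E \<times> UNIV)"

definition half_edge :: "'a set \<times> 'a \<times> bool \<Rightarrow> 'a set" where
  "half_edge = (\<lambda>(e, w, i). {w, m (e, i)})"

definition E' :: "'a set set" where
  "E' = half_edge ` (SIGMA e:E. e \<times> UNIV)"

lemma finite_V: "finite V" and finite_E: "finite E"
  using simple simple_graph_finite_edges by (auto simp: simple_graph_def)

lemma edge: "e \<in> E \<Longrightarrow> e \<subseteq> V" "e \<in> E \<Longrightarrow> card e = 2"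
  using simple by (auto simp: simple_graph_def)

lemma m_notin: "e \<in> E \<Longrightarrow> m (e, i) \<notin> V"
  using fresh by blast

lemma m_eq_iff: "e \<in> E \<Longrightarrow> e' \<in> E \<Longrightarrow> m (e, i) = m (e', i') \<longleftrightarrow> e = e' \<and> i = i'"
  using inj_m by (auto simp: inj_on_def)

text \<open>Each such edge has one old and one new endpoint, so the two cannot be swapped.\<close>

lemma half_edge_eq_iff:
  assumes "e \<in> E" "e' \<in> E" "w \<in> V" "w' \<in> V"
  shows "{w, m (e, i)} = {w', m (e', i')} \<longleftrightarrow> w = w' \<and> e = e' \<and> i = i'"
  using assms m_notin m_eq_iff by (metis doubleton_eq_iff)

lemma inj_half_edge: "inj_on half_edge (SIGMA e:E. e \<times> UNIV)"
proof -
  have "e = e' \<and> w = w' \<and> i = i'"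
    if "e \<in> E" "w \<in> e" "e' \<in> E" "w' \<in> e'" "{w, m (e, i)} = {w', m (e', i')}" for e w i e' w' i'
    using that half_edge_eq_iff[of e e' w w' i i'] edge(1) by auto
  then show ?thesis unfolding inj_on_def half_edge_def by auto
qed

lemma simple': "simple_graph V' E'"
proof -
  have "w \<noteq> m (e, i)" "w \<in> V" if "e \<in> E" "w \<in> e" for w e i
    using edge(1) that m_notin by blast+
  then show ?thesis
    using finite_V finite_E by (auto simp: simple_graph_def V'_def E'_def half_edge_def card_insert_if)
qed

lemma card_V': "card V' = card V + 2 * card E"
  using finite_V finite_E fresh inj_m unfolding V'_def
  by (subst card_Un_disjoint) (auto simp: card_image card_cartesian_product)

section \<open>Subgraphs of the subdivided graph, given by a part \<open>f e\<close> of each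
  diamond\<close>

context
  fixes f :: "'a set \<Rightarrow> ('a \<times> bool) set"
  assumes f: "\<And>e. e \<in> E \<Longrightarrow> f e \<subseteq> e \<times> UNIV"
begin

lemma f_V: "e \<in> E \<Longrightarrow> (w, i) \<in> f e \<Longrightarrow> w \<in> V"
  using f edge(1) by blast

lemma edge_subgraph_cases:
  assumes "{x, y} \<in> half_edge ` Sigma E f"
  obtains e i where "e \<in> E" "(x, i) \<in> f e" "y = m (e, i)" "x \<in> V"
  | e i where "e \<in> E" "(y, i) \<in> f e" "x = m (e, i)" "y \<in> V"
  using assms f_V by (auto simp: half_edge_def doubleton_eq_iff)

text \<open>Projects walks to the original graph. The second conjunct strengthens the induction: at
  a new vertex, all its neighbours must already be reachable by linked edges.\<close>

lemma path_projects:
  assumes "(u, x) \<in> (adj_rel (half_edge ` Sigma E f))\<^sup>*" "u \<in> V"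
  defines "L \<equiv> (adj_rel {e \<in> E. linked e (f e)})\<^sup>*"
  shows "(x \<in> V \<longrightarrow> (u, x) \<in> L) \<and>
    (\<forall>e i w. e \<in> E \<longrightarrow> x = m (e, i) \<longrightarrow> (w, i) \<in> f e \<longrightarrow> (u, w) \<in> L)"
  using assms(1)
proof (induction rule: rtrancl_induct)
  case base
  show ?case using assms(2) m_notin by (auto simp: L_def)
next
  case (step y x)
  from step(2) have "{y, x} \<in> half_edge ` Sigma E f" by (simp add: adj_rel_iff)
  then show ?case
  proof (cases rule: edge_subgraph_cases)
    case (1 e i)
    have uy: "(u, y) \<in> L" using step 1 by blast
    have "(u, w) \<in> L" if w: "(w, i) \<in> f e" for w
    proof (cases "w = y")
      case False
      have "w \<in> e" "y \<in> e" using w 1 f by auto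
      \<comment> \<open>The walk entered the new vertex from \<open>y\<close>; a second neighbour
        \<open>w\<close> means that both ends of \<open>e\<close> are attached to it, so
        \<open>e\<close> is linked.\<close>
      then have "e = {y, w}" using False edge(2)[OF 1(1)] by (auto simp: card_2_iff)
      moreover have "linked e (f e)" unfolding linked_def using calculation w 1 by blast
      ultimately have "(y, w) \<in> adj_rel {e \<in> E. linked e (f e)}"
        using 1 by (simp add: adj_rel_iff)
      then show ?thesis using uy unfolding L_def by (meson rtrancl.rtrancl_into_rtrancl)
    qed (use uy in simp)
    then show ?thesis using 1 m_notin[OF 1(1)] by (auto simp: m_eq_iff)
  next
    \<comment> \<open>The walk leaves a new vertex, and the second conjunct covers the old vertex it
      reaches.\<close>
    case (2 e i)
    then show ?thesis using step.IH m_notin by auto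
  qed
qed

text \<open>Walks between old vertices project to linked edges, and each linked edge lifts to a path
  of length two. A new vertex is adjacent to old vertices only, so it is joined to the rest iff it
  has an edge.\<close>

lemma connected_subgraph_iff:
  "graph_connected V' (half_edge ` Sigma E f) \<longleftrightarrow>
    graph_connected V {e \<in> E. linked e (f e)} \<and> (\<forall>e\<in>E. attached (f e))"
  (is "graph_connected V' ?F \<longleftrightarrow> graph_connected V ?L \<and> _")
proof (intro iffI conjI ballI)
  assume C: "graph_connected V' ?F"
  have ne: "V \<noteq> {}"
  \<comment> \<open>\<open>V'\<close> could only owe its vertices to some edge, whose endpoints are
    in \<open>V\<close>.\<close>
  proof -
    have "V \<noteq> {} \<or> E \<noteq> {}" using C by (auto simp: graph_connected_def V'_def)
    moreover have "e \<noteq> {}" if "e \<in> E" for e using edge(2)[OF that] by auto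
    ultimately show ?thesis using edge(1) by blast
  qed
  show "graph_connected V ?L"
    unfolding graph_connected_def using C ne path_projects
    by (auto simp: graph_connected_def V'_def)
  show "attached (f e)" if e: "e \<in> E" for e
    unfolding attached_def
  proof
    fix i
    obtain v where v: "v \<in> V" using ne by blast
    \<comment> \<open>The first step of a walk from the new vertex to an old one supplies the
      required edge.\<close>
    have "(m (e, i), v) \<in> (adj_rel ?F)\<^sup>*"
      using C e v by (auto simp: graph_connected_def V'_def)
    moreover have "m (e, i) \<noteq> v" using v e m_notin by blast
    ultimately obtain y where "{m (e, i), y} \<in> ?F"
      by (metis adj_rel_iff converse_rtranclE)
    then show "\<exists>w. (w, i) \<in> f e"
      by (cases rule: edge_subgraph_cases) (use e m_notin in \<open>auto simp: m_eq_iff\<close>)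
  qed
next
  assume C: "graph_connected V ?L \<and> (\<forall>e\<in>E. attached (f e))"
  have half: "(w, m (e, i)) \<in> adj_rel ?F" if "e \<in> E" "(w, i) \<in> f e" for e w i
    using that by (force simp: adj_rel_iff half_edge_def)
  have "adj_rel ?L \<subseteq> (adj_rel ?F)\<^sup>*"
  proof clarify
    fix x y assume "(x, y) \<in> adj_rel ?L"
    then obtain i where "{x, y} \<in> E" "(x, i) \<in> f {x, y}" "(y, i) \<in> f {x, y}"
      by (auto simp: adj_rel_iff linked_def)
    then have "(x, m ({x, y}, i)) \<in> (adj_rel ?F)\<^sup>*" "(y, m ({x, y}, i)) \<in> (adj_rel ?F)\<^sup>*"
      using half by blast+
    then show "(x, y) \<in> (adj_rel ?F)\<^sup>*" by (meson rtrancl_trans sym_adj_rel_rtrancl)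
  qed
  then have LF: "(adj_rel ?L)\<^sup>* \<subseteq> (adj_rel ?F)\<^sup>*" by (metis rtrancl_idemp rtrancl_mono)
  obtain v where v: "v \<in> V" using C by (auto simp: graph_connected_def)
  have VV: "(x, v) \<in> (adj_rel ?F)\<^sup>*" if "x \<in> V" for x
    using that v C LF by (auto simp: graph_connected_def)
  have to_v: "(x, v) \<in> (adj_rel ?F)\<^sup>*" if x: "x \<in> V'" for x
  proof (cases "x \<in> V")
    case False
    then obtain e i where ei: "e \<in> E" "x = m (e, i)" using x unfolding V'_def by blast
    then obtain w where w: "(w, i) \<in> f e" using C unfolding attached_def by blast
    have "(x, w) \<in> (adj_rel ?F)\<^sup>*"
      using half[OF ei(1) w] ei by (blast intro: sym_adj_rel_rtrancl)
    then show ?thesis using VV[OF f_V[OF ei(1) w]] by (rule rtrancl_trans)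
  qed (use VV in blast)
  then show "graph_connected V' ?F"
    unfolding graph_connected_def using v
    by (auto simp: V'_def intro: rtrancl_trans[OF to_v sym_adj_rel_rtrancl[OF to_v]])
qed

lemma card_subgraph: "card (half_edge ` Sigma E f) = (\<Sum>e\<in>E. card (f e))"
proof -
  have "Sigma E f \<subseteq> (SIGMA e:E. e \<times> UNIV)" using f by blast
  then have "card (half_edge ` Sigma E f) = card (Sigma E f)"
    by (intro card_image inj_on_subset[OF inj_half_edge])
  also have "\<dots> = (\<Sum>e\<in>E. card (f e))"
    using finite_E finite_diamond_subset[OF edge(2) f] by (intro card_SigmaI) auto
  finally show ?thesis .
qed

lemma sum_part_sizes: "(\<Sum>e\<in>E. if P e then 3 else 2) = 2 * card E + card {e \<in> E. P e}"
proof -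
  have "(\<Sum>e\<in>E. if P e then 3 else 2) = (\<Sum>e\<in>E. 2 + (if P e then 1 else 0 :: nat))"
    by (intro sum.cong) auto
  also have "\<dots> = 2 * card E + card {e \<in> E. P e}"
    using finite_E by (simp only: sum.distrib) (simp flip: sum.inter_filter)
  finally show ?thesis .
qed

text \<open>For connected \<open>?F\<close>, the parts have at least
  \<open>2 * card E + card ?L\<close> edges in total, and \<open>card ?L + 1\<close> is at least
  \<open>card V\<close>. The edge count of a tree on \<open>V'\<close> makes both bounds tight, so
  \<open>?L\<close> is a tree and every part is extremal.\<close>

lemma tree_subgraph_iff:
  "half_edge ` Sigma E f \<in> spanning_trees V' E' \<longleftrightarrow>
    {e \<in> E. linked e (f e)} \<in> spanning_trees V E \<and> (\<forall>e\<in>E. f e \<in> diamond_parts e (linked e (f e)))"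
  (is "?F \<in> _ \<longleftrightarrow> ?L \<in> _ \<and> _")
proof -
  let ?s = "\<lambda>e. if linked e (f e) then 3 else 2 :: nat"
  have FE: "?F \<subseteq> E'" using f unfolding E'_def by blast
  have sF: "simple_graph V' ?F" using simple_graph_subset[OF simple' FE] .
  have sL: "simple_graph V ?L" by (rule simple_graph_subset[OF simple]) blast
  have F: "?F \<in> spanning_trees V' E' \<longleftrightarrow> graph_connected V ?L \<and> (\<forall>e\<in>E. attached (f e)) \<and>
      (\<Sum>e\<in>E. card (f e)) + 1 = card V + 2 * card E"
    using FE sF by (simp add: spanning_trees_def is_tree_iff_card connected_subgraph_iff
        card_subgraph card_V')
  have L: "?L \<in> spanning_trees V E \<longleftrightarrow> graph_connected V ?L \<and> card ?L + 1 = card V"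
    using sL by (auto simp: spanning_trees_def is_tree_iff_card)
  show ?thesis
  proof
    assume "?F \<in> spanning_trees V' E'"
    with F have C: "graph_connected V ?L" and A: "\<And>e. e \<in> E \<Longrightarrow> attached (f e)"
      and c: "(\<Sum>e\<in>E. card (f e)) + 1 = card V + 2 * card E" by auto
    have le: "?s e \<le> card (f e)" if "e \<in> E" for e
      using attached_card(1)[OF edge(2) f A] that by blast
    have "sum ?s E \<le> (\<Sum>e\<in>E. card (f e))" by (intro sum_mono le)
    moreover have "card V \<le> card ?L + 1" by (rule connected_card_le[OF sL C])
    ultimately have eq: "sum ?s E = (\<Sum>e\<in>E. card (f e))" "card ?L + 1 = card V"
      using c sum_part_sizes[of "\<lambda>e. linked e (f e)"] by linarith+
    \<comment> \<open>Equal sums of termwise ordered summands agree term by term.\<close>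
    have "card (f e) = ?s e" if "e \<in> E" for e
      using sum_mono_inv[OF eq(1) le that finite_E] by simp
    then have "\<forall>e\<in>E. f e \<in> diamond_parts e (linked e (f e))"
      using attached_card(2)[OF edge(2) f A] by blast
    then show "?L \<in> spanning_trees V E \<and> (\<forall>e\<in>E. f e \<in> diamond_parts e (linked e (f e)))"
      using L C eq(2) by blast
  next
    assume *: "?L \<in> spanning_trees V E \<and> (\<forall>e\<in>E. f e \<in> diamond_parts e (linked e (f e)))"
    then have "(\<Sum>e\<in>E. card (f e)) = sum ?s E"
      by (intro sum.cong) (auto dest!: diamond_parts_card bspec)
    moreover have "\<forall>e\<in>E. attached (f e)"
      using * diamond_parts_attached_linked(1)[OF edge(2)] by blast
    ultimately show "?F \<in> spanning_trees V' E'"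
      using F L * sum_part_sizes[of "\<lambda>e. linked e (f e)"] by auto
  qed
qed

end

section \<open>Encoding and counting the spanning trees of the subdivided graph\<close>

abbreviation tree_codes :: "'a set set \<Rightarrow> ('a set \<Rightarrow> ('a \<times> bool) set) set" where
  "tree_codes T \<equiv> PiE E (\<lambda>e. diamond_parts e (e \<in> T))"

lemma tree_codes_subset: "g \<in> tree_codes T \<Longrightarrow> e \<in> E \<Longrightarrow> g e \<subseteq> e \<times> UNIV"
  by (rule diamond_parts_subset[of _ _ "e \<in> T"]) (rule PiE_mem)

lemma tree_codes_linked:
  assumes "g \<in> tree_codes T" "e \<in> E"
  shows "linked e (g e) \<longleftrightarrow> e \<in> T"
  using assms diamond_parts_attached_linked(2)[OF edge(2)] by (meson PiE_mem)

lemma spanning_trees_step: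
  "spanning_trees V' E' = (\<lambda>g. half_edge ` Sigma E g) ` (\<Union>T\<in>spanning_trees V E. tree_codes T)"
proof (intro equalityI subsetI)
  fix F assume F: "F \<in> spanning_trees V' E'"
  \<comment> \<open>Decodes \<open>F\<close> diamond by diamond; \<open>restrict\<close> makes
    \<open>g\<close> extensional, as membership in \<open>PiE\<close> demands.\<close>
  define g where "g = restrict (\<lambda>e. {p \<in> e \<times> UNIV. half_edge (e, p) \<in> F}) E"
  have g: "g e \<subseteq> e \<times> UNIV" if "e \<in> E" for e using that by (auto simp: g_def)
  have "F \<subseteq> E'" using F by (auto simp: spanning_trees_def)
  then have F_eq: "F = half_edge ` Sigma E g"
    by (force simp: g_def E'_def)
  have "{e \<in> E. linked e (g e)} \<in> spanning_trees V E"
    and "\<forall>e\<in>E. g e \<in> diamond_parts e (linked e (g e))"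
    using F tree_subgraph_iff[of g, OF g] unfolding F_eq by auto
  then have "g \<in> (\<Union>T\<in>spanning_trees V E. tree_codes T)"
    by (intro UN_I[of "{e \<in> E. linked e (g e)}"]) (auto simp: PiE_def g_def)
  then show "F \<in> (\<lambda>g. half_edge ` Sigma E g) ` (\<Union>T\<in>spanning_trees V E. tree_codes T)"
    using F_eq by blast
next
  fix F assume "F \<in> (\<lambda>g. half_edge ` Sigma E g) ` (\<Union>T\<in>spanning_trees V E. tree_codes T)"
  then obtain g T where gT: "T \<in> spanning_trees V E" "g \<in> tree_codes T"
    and F_eq: "F = half_edge ` Sigma E g" by blast
  have "{e \<in> E. linked e (g e)} = T"
    using tree_codes_linked[OF gT(2)] gT(1) by (auto simp: spanning_trees_def)
  moreover have "\<forall>e\<in>E. g e \<in> diamond_parts e (linked e (g e))"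
    using gT(2) tree_codes_linked[OF gT(2)] by (auto simp: PiE_mem)
  ultimately show "F \<in> spanning_trees V' E'"
    using tree_subgraph_iff[of g, OF tree_codes_subset[OF gT(2)]] gT(1) F_eq by simp
qed

text \<open>Injectivity of \<open>half_edge\<close> recovers \<open>Sigma E g\<close>, hence
  \<open>g\<close> on \<open>E\<close>; outside \<open>E\<close> extensionality fixes it.\<close>

lemma inj_on_tree_codes:
  "inj_on (\<lambda>g. half_edge ` Sigma E g) (\<Union>T\<in>spanning_trees V E. tree_codes T)"
proof (rule inj_onI)
  fix g h
  assume g: "g \<in> (\<Union>T\<in>spanning_trees V E. tree_codes T)"
    and h: "h \<in> (\<Union>T\<in>spanning_trees V E. tree_codes T)"
    and eq: "half_edge ` Sigma E g = half_edge ` Sigma E h"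
  have "Sigma E g \<subseteq> (SIGMA e:E. e \<times> UNIV)" "Sigma E h \<subseteq> (SIGMA e:E. e \<times> UNIV)"
    using g h tree_codes_subset by blast+
  then have "Sigma E g = Sigma E h"
    using inj_on_image_eq_iff[OF inj_half_edge] eq by metis
  then have "g e = h e" if "e \<in> E" for e using that by blast
  moreover have "g \<in> extensional E" "h \<in> extensional E" using g h by (auto simp: PiE_def)
  ultimately show "g = h" by (metis extensionalityI)
qed

text \<open>Every spanning tree \<open>T\<close> of the original graph has 4 parts to choose from at
  each edge, and a code determines its \<open>T\<close> as the set of linked edges.\<close>

lemma num_spanning_trees_step:
  "num_spanning_trees V' E' = num_spanning_trees V E * 4 ^ card E"
proof -
  have fin: "finite (spanning_trees V E)"
    using finite_E by (auto simp: spanning_trees_def intro: finite_subset[of _ "Pow E"])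
  have card_codes: "card (tree_codes T) = 4 ^ card E" for T
    using finite_E edge(2) by (simp add: card_PiE card_diamond_parts)
  \<comment> \<open>Infinite sets have \<open>card\<close> 0, whereas a power of 4 is
    nonzero.\<close>
  have fin_codes: "finite (tree_codes T)" for T
    using card_codes[of T] by (metis card.infinite power_not_zero zero_neq_numeral)
  have disj: "tree_codes T \<inter> tree_codes U = {}"
    if "T \<in> spanning_trees V E" "U \<in> spanning_trees V E" "T \<noteq> U" for T U
  proof -
    have "T = U" if "g \<in> tree_codes T" "g \<in> tree_codes U" for g
      using tree_codes_linked[OF that(1)] tree_codes_linked[OF that(2)]
        \<open>T \<in> spanning_trees V E\<close> \<open>U \<in> spanning_trees V E\<close>
      by (auto simp: spanning_trees_def)
    then show ?thesis using that(3) by blast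
  qed
  have "num_spanning_trees V' E' = card (\<Union>T\<in>spanning_trees V E. tree_codes T)"
    unfolding num_spanning_trees_def spanning_trees_step by (rule card_image[OF inj_on_tree_codes])
  also have "\<dots> = (\<Sum>T\<in>spanning_trees V E. card (tree_codes T))"
    using fin fin_codes disj by (intro card_UN_disjoint) auto
  also have "\<dots> = num_spanning_trees V E * 4 ^ card E"
    by (simp add: card_codes num_spanning_trees_def)
  finally show ?thesis .
qed

end

section \<open>The Diamond fractal\<close>

text \<open>The only competitor is the empty edge set, which the edge count excludes.\<close>

lemma num_spanning_trees_single_edge:
  assumes "x1 \<noteq> x2"
  shows "num_spanning_trees {x1, x2} {{x1, x2}} = 1"
proof -
  have "graph_connected {x1, x2} {{x1, x2}}"
    by (auto simp: graph_connected_def adj_rel_iff insert_commute intro!: r_into_rtrancl)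
  then have "spanning_trees {x1, x2} {{x1, x2}} = {{{x1, x2}}}"
    using assms
    by (auto simp: spanning_trees_def is_tree_iff_card simple_graph_def subset_singleton_iff)
  then show ?thesis by (simp add: num_spanning_trees_def)
qed

text \<open>Passing from level \<open>k\<close> to \<open>Suc k\<close> contributes a factor
  \<open>4 ^ (4 ^ k)\<close>, since level \<open>k\<close> has \<open>4 ^ k\<close> edges.\<close>

lemma num_spanning_trees_diamond:
  assumes "diamond_graph n V E"
  shows "num_spanning_trees V E = 4 ^ (\<Sum>k<n. 4 ^ k)"
  using assms
proof (induction rule: diamond_graph.induct)
  case (diamond_0 x1 x2)
  then show ?case by (simp add: num_spanning_trees_single_edge)
next
  case (diamond_Suc n V E a b)
  define m where "m = (\<lambda>(e, i). if i then a e else b e)"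
  interpret diamond_step V E m
  proof
    show "simple_graph V E" using diamond_graph_simple[OF diamond_Suc.hyps(1)] .
    show "inj_on m (E \<times> UNIV)"
      using diamond_Suc.hyps by (auto simp: inj_on_def m_def split: if_splits)
    show "m ` (E \<times> UNIV) \<inter> V = {}"
      using diamond_Suc.hyps(5) by (fastforce simp: m_def split: if_splits)
  qed
  have "V' = V \<union> a ` E \<union> b ` E"
    unfolding V'_def by (auto simp: m_def image_iff all_bool_eq split: if_splits)
  moreover have "E' = {{w, a e} | w e. e \<in> E \<and> w \<in> e} \<union> {{w, b e} | w e. e \<in> E \<and> w \<in> e}"
  proof -
    have "E' = (\<Union>i. {half_edge (e, w, i) | w e. e \<in> E \<and> w \<in> e})"
      unfolding E'_def by blast
    then show ?thesis unfolding half_edge_def by (simp add: UNIV_bool m_def Un_commute)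
  qed
  ultimately show ?case
    using num_spanning_trees_step diamond_Suc.IH diamond_graph_card_edges[OF diamond_Suc.hyps(1)]
    by (simp add: power_add)
qed

theorem theorem5p7:
  fixes n :: nat and V :: "'a set" and E :: "'a set set"
  assumes "n \<ge> 1"
    and "diamond_graph n V E"
  shows "real (num_spanning_trees V E) = 2 powr (2 / 3 * (4 ^ n - 1))"
proof -
  let ?s = "\<Sum>k<n. 4 ^ k :: nat"
  \<comment> \<open>The geometric series turns the exponent of the claim into the natural number
    \<open>2 * ?s\<close>, so \<open>powr\<close> becomes an ordinary power and
    \<open>4 = 2 ^ 2\<close> finishes.\<close>
  have "3 * real ?s = 4 ^ n - 1"
    by (induction n) (auto simp: algebra_simps)
  then have "2 / 3 * (4 ^ n - 1) = real (2 * ?s)" by simp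
  then have "2 powr (2 / 3 * (4 ^ n - 1)) = (2 :: real) ^ (2 * ?s)"
    by (metis powr_realpow zero_less_numeral)
  then show ?thesis
    using num_spanning_trees_diamond[OF assms(2)] by (simp add: power_mult)
qed

end
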